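(* Consider the linear system $$\boldsymbol{\psi}(n-e_i,x)-\boldsymbol{\psi}(n-e_j,x)=\boldsymbol{\psi}(n,x)\,U_{ij}(n),\qquad U_{ij}(n)=-\rho^i(n)[\rho^i(n-e_j)]^{-1},\qquad 1\le i\ne j\le m,$$ together with the additional equation $$x\,\boldsymbol{\psi}(n,x)=\boldsymbol{\psi}(n+e_1,x)\,\rho^1(n+e_1)[\rho^1(n)]^{-1}+\dots+\boldsymbol{\psi}(n+e_m,x)\,\rho^m(n+e_m)[\rho^m(n)]^{-1}.$$ The compatibility condition of the linear system with the additional equation is the non-Abelian Hirota--Miwa system $$\rho^j(n)[\rho^j(n-e_i)]^{-1}+\rho^i(n)[\rho^i(n-e_j)]^{-1}=0,\qquad i\neq j,$$ $$\rho^i(n)[\rho^i(n-e_j)]^{-1}+\rho^j(n)[\rho^j(n-e_k)]^{-1}+\rho^k(n)[\rho^k(n-e_i)]^{-1}=0,\qquad i,j,k\ \text{distinct},$$ supplemented by the constraint $$\rho^1(n+e_1)[\rho^1(n)]^{-1}+\dots+\rho^m(n+e_m)[\rho^m(n)]^{-1}=1-F(|n|),$$ where $F\colon\mathbb{Z}\to\mathbb{D}$ is a function of the single variable $|n|=n_1+\dots+n_m$.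
   Context: $\mathbb{D}$ is a division ring, $m\ge 2$ (for $m=2$ the three-index equations are void), $n=(n_1,\dots,n_m)\in\mathbb{Z}^m$, and $e_i$ is the $i$th standard basis vector of $\mathbb{Z}^m$. The wave function $\boldsymbol{\psi}$ is defined on $\mathbb{Z}^m$, takes values in a right vector space over $\mathbb{D}$, and depends on a parameter $x$ that commutes with the elements of $\mathbb{D}$. The potentials $\rho^i\colon\mathbb{Z}^m\to\mathbb{D}$, $i=1,\dots,m$, are functions with invertible values (so that the formulas make sense) that do not depend on $x$. They are general potentials on the lattice, not restricted to those arising from Hermite--Padé approximation or to any special region of $\mathbb{Z}^m$. All equations are understood to hold for every $n$. *)

theory Defs
  imports "HOL-Analysis.Analysis"
begin

text \<open>
  Right vector spaces over a division ring; the library's \<^locale>\<open>vector_space\<close> needs a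
  commutative field.  As there, the carrier is the whole type.
\<close>

locale right_vector_space =
  fixes smul :: "'v::ab_group_add \<Rightarrow> 'd::division_ring \<Rightarrow> 'v"  (infixl "\<bullet>\<^sub>R" 75)
  assumes smul_add_left: "(v + w) \<bullet>\<^sub>R a = v \<bullet>\<^sub>R a + w \<bullet>\<^sub>R a"
    and smul_add_right: "v \<bullet>\<^sub>R (a + b) = v \<bullet>\<^sub>R a + v \<bullet>\<^sub>R b"
    and smul_smul: "(v \<bullet>\<^sub>R a) \<bullet>\<^sub>R b = v \<bullet>\<^sub>R (a * b)"
    and smul_one: "v \<bullet>\<^sub>R 1 = v"

text \<open>
  The parameter \<open>x\<close> enters only through multiplication of vectors by it.  It runs over an
  arbitrary type \<open>'x\<close>, and multiplication by each of its values is an additive bijection commuting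
  with the scalars.  This covers nonzero central elements of the division ring, nonzero values in a
  field acting on \<open>'v\<close> from the left, and (with a one-element \<open>'x\<close>) an invertible central
  indeterminate, as for wave functions that are formal Laurent series in \<open>1/x\<close>.  Degenerate values
  such as \<open>x = 0\<close> have to be excluded: there the additional equation is a linear relation between
  the neighbouring values of the wave function and no longer determines its value at \<open>n\<close>.
\<close>

locale right_vector_space_with_parameter = right_vector_space smul
  for smul :: "'v::ab_group_add \<Rightarrow> 'd::division_ring \<Rightarrow> 'v" +
  fixes xmul :: "'x \<Rightarrow> 'v \<Rightarrow> 'v"
  assumes xmul_add: "xmul x (v + w) = xmul x v + xmul x w"
    and xmul_smul: "xmul x (smul v a) = smul (xmul x v) a"
    and bij_xmul: "bij (xmul x)"

abbreviation basis_vec :: "'m::finite \<Rightarrow> int ^ 'm"  ("\<e>")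
  where "\<e> i \<equiv> axis i 1"

definition weight :: "int ^ 'm::finite \<Rightarrow> int"
  where "weight n = (\<Sum>i\<in>UNIV. n $ i)"

definition U :: "('m::finite \<Rightarrow> int ^ 'm \<Rightarrow> 'd::division_ring) \<Rightarrow> 'm \<Rightarrow> 'm \<Rightarrow> int ^ 'm \<Rightarrow> 'd"
  where "U \<rho> i j n = - \<rho> i n * inverse (\<rho> i (n - \<e> j))"

definition linear_system ::
  "('v::ab_group_add \<Rightarrow> 'd::division_ring \<Rightarrow> 'v) \<Rightarrow>
   ('m::finite \<Rightarrow> int ^ 'm \<Rightarrow> 'd) \<Rightarrow> (int ^ 'm \<Rightarrow> 'x \<Rightarrow> 'v) \<Rightarrow> bool"
  where "linear_system smul \<rho> \<psi> \<longleftrightarrow>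
    (\<forall>n x i j. i \<noteq> j \<longrightarrow> \<psi> (n - \<e> i) x - \<psi> (n - \<e> j) x = smul (\<psi> n x) (U \<rho> i j n))"

definition additional_equation ::
  "('v::ab_group_add \<Rightarrow> 'd::division_ring \<Rightarrow> 'v) \<Rightarrow> ('x \<Rightarrow> 'v \<Rightarrow> 'v) \<Rightarrow>
   ('m::finite \<Rightarrow> int ^ 'm \<Rightarrow> 'd) \<Rightarrow> (int ^ 'm \<Rightarrow> 'x \<Rightarrow> 'v) \<Rightarrow> bool"
  where "additional_equation smul xmul \<rho> \<psi> \<longleftrightarrow>
    (\<forall>n x. xmul x (\<psi> n x) =
      (\<Sum>i\<in>UNIV. smul (\<psi> (n + \<e> i) x) (\<rho> i (n + \<e> i) * inverse (\<rho> i n))))"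

text \<open>
  Compatibility is solvability for arbitrary initial data.  The appropriate data are the values at
  the \<open>m\<close> neighbours \<open>n\<^sub>0 + e\<^sub>i\<close> of a site: the additional equation at \<open>n\<^sub>0\<close> gives the value at \<open>n\<^sub>0\<close>,
  and the linear equations at the sites \<open>n\<^sub>0 + e\<^sub>i\<close> then give the values at \<open>n\<^sub>0 + e\<^sub>i - e\<^sub>j\<close>, that is,
  the same kind of data at the site \<open>n\<^sub>0 - e\<^sub>j\<close>.  This step can be inverted, so the data
  determine a common solution on the whole lattice.  The only question is whether
  different ways of propagating them agree, i.e. whether the equations impose no further relation
  on the data.
\<close>

definition compatible ::
  "('v::ab_group_add \<Rightarrow> 'd::division_ring \<Rightarrow> 'v) \<Rightarrow> ('x \<Rightarrow> 'v \<Rightarrow> 'v) \<Rightarrow>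
   ('m::finite \<Rightarrow> int ^ 'm \<Rightarrow> 'd) \<Rightarrow> bool"
  where "compatible smul xmul \<rho> \<longleftrightarrow>
    (\<forall>n\<^sub>0. \<forall>v :: 'm \<Rightarrow> 'x \<Rightarrow> 'v. \<exists>\<psi>.
      linear_system smul \<rho> \<psi> \<and> additional_equation smul xmul \<rho> \<psi> \<and>
      (\<forall>i x. \<psi> (n\<^sub>0 + \<e> i) x = v i x))"

definition hirota_miwa :: "('m::finite \<Rightarrow> int ^ 'm \<Rightarrow> 'd::division_ring) \<Rightarrow> bool"
  where "hirota_miwa \<rho> \<longleftrightarrow>
    (\<forall>n i j. i \<noteq> j \<longrightarrow>
      \<rho> j n * inverse (\<rho> j (n - \<e> i)) + \<rho> i n * inverse (\<rho> i (n - \<e> j)) = 0) \<and>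
    (\<forall>n i j k. i \<noteq> j \<and> j \<noteq> k \<and> i \<noteq> k \<longrightarrow>
      \<rho> i n * inverse (\<rho> i (n - \<e> j)) + \<rho> j n * inverse (\<rho> j (n - \<e> k))
        + \<rho> k n * inverse (\<rho> k (n - \<e> i)) = 0)"

definition weight_constraint ::
  "('m::finite \<Rightarrow> int ^ 'm \<Rightarrow> 'd::division_ring) \<Rightarrow> (int \<Rightarrow> 'd) \<Rightarrow> bool"
  where "weight_constraint \<rho> F \<longleftrightarrow>
    (\<forall>n. (\<Sum>i\<in>UNIV. \<rho> i (n + \<e> i) * inverse (\<rho> i n)) = 1 - F (weight n))"

end

theory Submission
  imports Defs
begin

text \<open>
  Record a wave function by its states \<open>a(n) = (\<psi>(n + e\<^sub>i))\<^sub>i\<close>.  The equations express \<open>a(n - e\<^sub>j)\<close>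
  through \<open>a(n)\<close> by a bijective map.  Since \<open>\<psi>(n)\<close> can be prescribed, the linear system forces
  \<open>U\<close> to be antisymmetric and a cocycle in its indices, which is the Hirota--Miwa system.  Given this,
  the values of \<open>x (\<psi>(n - e\<^sub>j) - \<psi>(n - e\<^sub>k))\<close> obtained from the additional equation and from the
  linear system differ by \<open>\<psi>(n) (S(n - e\<^sub>j) - S(n - e\<^sub>k))\<close>, where \<open>S\<close> is the left-hand side of the
  constraint; so \<open>S\<close> depends on \<open>|n|\<close> only.  Conversely, under these conditions the maps are commuting
  bijections of the set of pairs (site, state), and their integer powers transport any initial state
  to the whole lattice.
\<close>

section \<open>Functions on the integer lattice\<close>

lemma translation_invariant_axis:
  fixes f :: "int ^ 'm::finite \<Rightarrow> 'b"
  assumes "\<And>n. f (n - \<e> j) = f n"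
  shows "f (n + axis j c) = f n"
proof (induction c rule: int_induct[where k = 0])
  case base
  show ?case by (simp add: axis_eq_0_iff[THEN iffD2])
next
  case (step1 c)
  have "n + axis j (c + 1) - \<e> j = n + axis j c"
    by (simp add: vec_eq_iff axis_def)
  then show ?case using assms[of "n + axis j (c + 1)"] step1 by metis
next
  case (step2 c)
  have "n + axis j (c - 1) = n + axis j c - \<e> j"
    by (simp add: vec_eq_iff axis_def)
  then show ?case using assms[of "n + axis j c"] step2 by metis
qed

lemma vec_eq_sum_axis: "n = (\<Sum>j\<in>UNIV. axis j (n $ j))"
  for n :: "int ^ 'm::finite"
  by (simp add: vec_eq_iff axis_def)

lemma translation_invariant_const:
  fixes f :: "int ^ 'm::finite \<Rightarrow> 'b"
  assumes "\<And>j n. f (n - \<e> j) = f n"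
  shows "f n = f n'"
proof -
  \<comment> \<open>Directions are added one at a time; the base point \<open>k\<close> must vary
    because each added direction displaces it.\<close>
  have "f (k + (\<Sum>j\<in>J. axis j (c j))) = f k" if "finite J" for J c k
    using that
  proof (induction J arbitrary: k)
    case (insert j J)
    have "f (k + (\<Sum>i\<in>insert j J. axis i (c i))) = f ((k + axis j (c j)) + (\<Sum>i\<in>J. axis i (c i)))"
      using insert by (simp add: add.assoc)
    then show ?case using insert.IH translation_invariant_axis[of f, OF assms] by simp
  qed simp
  from this[of UNIV 0 "\<lambda>j. n $ j"] this[of UNIV 0 "\<lambda>j. n' $ j"] show ?thesis
    by (simp flip: vec_eq_sum_axis)
qed

lemma weight_minus_basis_vec: "weight (n - \<e> j) = weight n - 1"
  by (simp add: weight_def sum_subtractf axis_def)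

text \<open>Sliding \<open>n\<close> along one fixed axis to the hyperplane of weight
  \<open>w\<close> and applying \<open>f\<close> gives \<open>h w n\<close>. This is invariant under
  unit steps: the two points compared are backward neighbours of the common point
  \<open>?p\<close>.\<close>

lemma function_of_weight:
  fixes f :: "int ^ 'm::finite \<Rightarrow> 'b"
  assumes "\<And>j k n. f (n - \<e> j) = f (n - \<e> k)"
  shows "\<exists>g. \<forall>n. f n = g (weight n)"
proof -
  fix k :: 'm
  define h where "h w n = f (n + axis k (w - weight n))" for w n
  have "h w (n - \<e> j) = h w n" for w j n
  proof -
    let ?p = "n + axis k (w - weight n + 1)"
    have "n - \<e> j + axis k (w - weight (n - \<e> j)) = ?p - \<e> j"
      "n + axis k (w - weight n) = ?p - \<e> k"
      unfolding weight_minus_basis_vec by (simp_all add: vec_eq_iff axis_def algebra_simps)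
    then show ?thesis unfolding h_def using assms[of ?p j k] by metis
  qed
  then have "h w n = h w 0" for w n by (rule translation_invariant_const)
  moreover have "f n = h (weight n) n" for n
    by (simp add: h_def axis_eq_0_iff[THEN iffD2])
  ultimately have "f n = h (weight n) 0" for n by simp
  then show ?thesis by (intro exI[of _ "\<lambda>w. h w 0"]) blast
qed

section \<open>Integer powers and transport by commuting bijections\<close>

definition int_funpow :: "('a \<Rightarrow> 'a) \<Rightarrow> int \<Rightarrow> 'a \<Rightarrow> 'a"
  where "int_funpow f c = (if c \<ge> 0 then f ^^ nat c else inv f ^^ nat (- c))"

lemma int_funpow_0 [simp]: "int_funpow f 0 y = y"
  by (simp add: int_funpow_def)

lemma int_funpow_add_1:
  assumes "bij f"
  shows "int_funpow f (c + 1) y = f (int_funpow f c y)"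
proof (cases "c \<ge> 0")
  case True
  then show ?thesis by (simp add: int_funpow_def nat_add_distrib)
next
  case False
  then have "nat (- c) = Suc (nat (- (c + 1)))" by simp
  then have "f ((inv f ^^ nat (- c)) y) = (inv f ^^ nat (- (c + 1))) y"
    using assms by (simp add: bij_is_surj surj_f_inv_f)
  \<comment> \<open>For \<open>c = -1\<close> the left side falls into the nonnegative branch; there
    both powers are the identity.\<close>
  moreover have "int_funpow f (c + 1) y = (inv f ^^ nat (- (c + 1))) y"
    using False by (cases "c + 1 = 0") (auto simp: int_funpow_def)
  ultimately show ?thesis using False by (simp add: int_funpow_def)
qed

lemma int_funpow_commute:
  assumes "bij f" and comm: "\<And>y. f (g y) = g (f y)"
  shows "int_funpow f c (g y) = g (int_funpow f c y)"
proof (induction c rule: int_induct[where k = 0])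
  case (step1 c)
  then show ?case by (simp add: int_funpow_add_1 assms)
next
  case (step2 c)
  \<comment> \<open>Going down, one application of \<open>f\<close> restores exponent
    \<open>c\<close>, and injectivity of \<open>f\<close> then cancels it.\<close>
  have "f (int_funpow f (c - 1) (g y)) = f (g (int_funpow f (c - 1) y))"
    using step2 int_funpow_add_1[OF assms(1), of "c - 1"] by (simp add: comm)
  then show ?case using assms(1) by (simp add: bij_is_inj inj_eq)
qed simp

text \<open>Directions are switched on one by one: \<open>P\<close> follows \<open>\<tau> j\<close>
  along \<open>j \<in> J\<close> and is constant along the others. Adjoining \<open>k\<close> twists
  \<open>P\<close> by powers of \<open>\<tau> k\<close>, which commute with every
  \<open>\<tau> j\<close>.\<close>

lemma commuting_bijections_orbit:
  fixes \<tau> :: "'m::finite \<Rightarrow> 'a \<Rightarrow> 'a"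
  assumes bij: "\<And>j. bij (\<tau> j)" and comm: "\<And>j k y. \<tau> j (\<tau> k y) = \<tau> k (\<tau> j y)"
  shows "\<exists>P. P n\<^sub>0 = y\<^sub>0 \<and> (\<forall>j n. P (n - \<e> j) = \<tau> j (P n))"
proof -
  have "\<exists>P. P n\<^sub>0 = y\<^sub>0 \<and> (\<forall>j n. P (n - \<e> j) = (if j \<in> J then \<tau> j (P n) else P n))"
    if "finite J" for J
    using that
  proof induction
    case empty
    show ?case by (intro exI[of _ "\<lambda>_. y\<^sub>0"]) simp
  next
    case (insert k J)
    then obtain P where P: "P n\<^sub>0 = y\<^sub>0"
      "\<And>j n. P (n - \<e> j) = (if j \<in> J then \<tau> j (P n) else P n)" by blast
    \<comment> \<open>A step by \<open>- \<e> k\<close> raises this exponent by one; it vanishes at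
      \<open>n\<^sub>0\<close>, so the initial value is kept.\<close>
    let ?P = "\<lambda>n. int_funpow (\<tau> k) (n\<^sub>0 $ k - n $ k) (P n)"
    have "?P (n - \<e> j) = (if j \<in> insert k J then \<tau> j (?P n) else ?P n)" for j n
    proof (cases "j = k")
      case True
      then have "P (n - \<e> j) = P n" "n\<^sub>0 $ k - (n - \<e> j) $ k = n\<^sub>0 $ k - n $ k + 1"
        using insert.hyps by (simp add: P(2), simp add: axis_def)
      with True show ?thesis using int_funpow_add_1[OF bij] by (metis insertI1)
    next
      case False
      then have "(n - \<e> j) $ k = n $ k" by (simp add: axis_def)
      moreover have "int_funpow (\<tau> k) c (\<tau> j y) = \<tau> j (int_funpow (\<tau> k) c y)" for c y
        using bij comm by (rule int_funpow_commute)
      ultimately show ?thesis using False by (cases "j \<in> J") (simp_all only: P(2) insert_iff if_True if_False simp_thms)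
    qed
    then show ?case using P(1) by (intro exI[of _ ?P]) simp
  qed
  from this[of UNIV] show ?thesis by simp
qed

text \<open>Carrying the site along with the state turns the site-dependent maps
  \<open>T j n\<close> into one bijection per direction, and flatness into commutativity.\<close>

corollary flat_transport:
  fixes T :: "'m::finite \<Rightarrow> int ^ 'm \<Rightarrow> 'a \<Rightarrow> 'a"
  assumes bij: "\<And>j n. bij (T j n)"
    and comm: "\<And>j k n y. T k (n - \<e> j) (T j n y) = T j (n - \<e> k) (T k n y)"
  shows "\<exists>a. a n\<^sub>0 = a\<^sub>0 \<and> (\<forall>j n. a (n - \<e> j) = T j n (a n))"
proof -
  define \<tau> where "\<tau> j = (\<lambda>(n, y). (n - \<e> j, T j n y))" for j
  have "bij (\<tau> j)" for j
  proof (rule bijI)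
    show "inj (\<tau> j)"
      using bij by (auto simp: inj_def \<tau>_def bij_def)
    show "surj (\<tau> j)"
    proof (rule surjI)
      show "\<tau> j (fst p + \<e> j, inv (T j (fst p + \<e> j)) (snd p)) = p" for p
        using bij by (simp add: \<tau>_def bij_is_surj surj_f_inv_f)
    qed
  qed
  moreover have "\<tau> j (\<tau> k p) = \<tau> k (\<tau> j p)" for j k p
    by (simp add: \<tau>_def split_beta comm diff_right_commute)
  ultimately obtain P where P: "P n\<^sub>0 = (n\<^sub>0, a\<^sub>0)" "\<And>j n. P (n - \<e> j) = \<tau> j (P n)"
    using commuting_bijections_orbit[of \<tau> n\<^sub>0 "(n\<^sub>0, a\<^sub>0)"] by blast
  \<comment> \<open>The site recorded in the orbit must be the actual site: their difference is
    translation invariant and vanishes at \<open>n\<^sub>0\<close>.\<close>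
  have "fst (P n) - n = fst (P n\<^sub>0) - n\<^sub>0" for n
    by (rule translation_invariant_const[where f = "\<lambda>n. fst (P n) - n"])
      (simp add: P \<tau>_def split: prod.split)
  then have "fst (P n) = n" for n by (simp add: P)
  then show ?thesis using P
    by (intro exI[of _ "\<lambda>n. snd (P n)"]) (simp add: \<tau>_def split_beta)
qed

section \<open>Propagation of the wave function\<close>

locale wave_potentials = right_vector_space_with_parameter smul xmul
  for smul :: "'v::ab_group_add \<Rightarrow> 'd::division_ring \<Rightarrow> 'v"  (infixl "\<bullet>\<^sub>R" 75)
    and xmul :: "'x \<Rightarrow> 'v \<Rightarrow> 'v" +
  fixes \<rho> :: "'m::finite \<Rightarrow> int ^ 'm \<Rightarrow> 'd"
  assumes \<rho>_nonzero: "\<rho> i n \<noteq> 0"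
begin

section \<open>Arithmetic of scalars and of the parameter\<close>

lemma smul_zero_left [simp]: "0 \<bullet>\<^sub>R a = 0"
  using smul_add_left[of 0 0 a] by simp

lemma smul_zero_right [simp]: "v \<bullet>\<^sub>R 0 = 0"
  using smul_add_right[of v 0 0] by simp

lemma smul_minus_right: "v \<bullet>\<^sub>R (- a) = - (v \<bullet>\<^sub>R a)"
  using smul_add_right[of v a "- a"] by (simp add: eq_neg_iff_add_eq_0 add.commute)

lemma smul_minus_left: "(- v) \<bullet>\<^sub>R a = - (v \<bullet>\<^sub>R a)"
  using smul_add_left[of v "- v" a] by (simp add: eq_neg_iff_add_eq_0 add.commute)

lemma smul_diff_right: "v \<bullet>\<^sub>R (a - b) = v \<bullet>\<^sub>R a - v \<bullet>\<^sub>R b"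
  using smul_add_right[of v a "- b"] by (simp add: smul_minus_right)

lemma smul_diff_left: "(v - w) \<bullet>\<^sub>R a = v \<bullet>\<^sub>R a - w \<bullet>\<^sub>R a"
  using smul_add_left[of v "- w" a] by (simp add: smul_minus_left)

lemma smul_sum_left: "(\<Sum>i\<in>I. v i) \<bullet>\<^sub>R a = (\<Sum>i\<in>I. v i \<bullet>\<^sub>R a)"
  by (induction I rule: infinite_finite_induct) (simp_all add: smul_add_left)

lemma smul_sum_right: "v \<bullet>\<^sub>R (\<Sum>i\<in>I. a i) = (\<Sum>i\<in>I. v \<bullet>\<^sub>R a i)"
  by (induction I rule: infinite_finite_induct) (simp_all add: smul_add_right)

lemma smul_eq_0_iff: "v \<bullet>\<^sub>R a = 0 \<longleftrightarrow> v = 0 \<or> a = 0"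
proof -
  have "v = (v \<bullet>\<^sub>R a) \<bullet>\<^sub>R inverse a" if "a \<noteq> 0"
    using that by (simp add: smul_smul smul_one)
  then show ?thesis by fastforce
qed

lemma xmul_diff: "xmul x (v - w) = xmul x v - xmul x w"
  using xmul_add[of x "v - w" w] by (simp add: eq_diff_eq)

lemma xmul_eq_iff: "xmul x v = xmul x w \<longleftrightarrow> v = w"
  using bij_xmul[of x] by (auto simp: bij_def inj_eq)

section \<open>Coefficients of the equations and their identities\<close>

definition A :: "'m \<Rightarrow> int ^ 'm \<Rightarrow> 'd"
  where "A i n = \<rho> i (n + \<e> i) * inverse (\<rho> i n)"

definition S :: "int ^ 'm \<Rightarrow> 'd"
  where "S n = (\<Sum>i\<in>UNIV. A i n)"

text \<open>Setting the diagonal to zero makes the case \<open>i = j\<close> of the propagation uniform with the others;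
  the value \<open>U \<rho> i i n\<close> itself is not zero.\<close>

definition W :: "'m \<Rightarrow> 'm \<Rightarrow> int ^ 'm \<Rightarrow> 'd"
  where "W i j n = (if i = j then 0 else U \<rho> i j n)"

lemma A_nonzero: "A i n \<noteq> 0"
  by (simp add: A_def \<rho>_nonzero)

lemma W_nonzero: "i \<noteq> j \<Longrightarrow> W i j n \<noteq> 0"
  by (simp add: W_def U_def \<rho>_nonzero)

text \<open>For \<open>i \<noteq> j\<close> both products telescope to
  \<open>- \<rho> i (n + \<e> i) * inverse (\<rho> i (n - \<e> j))\<close>.\<close>

lemma W_mult_A: "W i j (n + \<e> i) * A i (n - \<e> j) = A i n * W i j n"
proof -
  have eq: "n - \<e> j + \<e> i = n + \<e> i - \<e> j" by simp
  have "\<rho> i (n + \<e> i) * inverse (\<rho> i (n + \<e> i - \<e> j)) *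
      (\<rho> i (n + \<e> i - \<e> j) * inverse (\<rho> i (n - \<e> j)))
    = \<rho> i (n + \<e> i) * (inverse (\<rho> i (n + \<e> i - \<e> j)) * \<rho> i (n + \<e> i - \<e> j)) * inverse (\<rho> i (n - \<e> j))"
    by (simp only: mult.assoc)
  also have "\<dots> = \<rho> i (n + \<e> i) * inverse (\<rho> i n) * (\<rho> i n * inverse (\<rho> i (n - \<e> j)))"
    by (simp add: \<rho>_nonzero mult.assoc flip: mult.assoc[of "inverse (\<rho> i n)"])
  finally show ?thesis
    by (simp add: W_def U_def A_def eq)
qed

text \<open>Off the diagonal both products telescope to
  \<open>\<rho> i n * inverse (\<rho> i (n - \<e> j - \<e> k))\<close>, which is symmetric in
  \<open>j\<close> and \<open>k\<close>.\<close>

lemma W_mult_W: "W i j n * W i k (n - \<e> j) = W i k n * W i j (n - \<e> k)"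
proof -
  have *: "\<rho> i n * inverse (\<rho> i (n - \<e> j)) * (\<rho> i (n - \<e> j) * inverse (\<rho> i (n - \<e> j - \<e> k)))
    = \<rho> i n * inverse (\<rho> i (n - \<e> j - \<e> k))" for j k
    by (simp add: \<rho>_nonzero mult.assoc flip: mult.assoc[of "inverse (\<rho> i (n - \<e> j))"])
  have eq: "n - \<e> k - \<e> j = n - \<e> j - \<e> k" by simp
  show ?thesis
    using *[of j k] *[of k j] by (simp add: W_def U_def eq)
qed

text \<open>Since \<open>W\<close> vanishes on the diagonal, the cocycle relation with
  \<open>k = i\<close> is the two-index equation; distinct indices give the three-index one.\<close>

lemma hirota_miwa_iff_W:
  "hirota_miwa \<rho> \<longleftrightarrow> (\<forall>i j k n. W i j n + W j k n + W k i n = 0)"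
proof -
  have two: "\<rho> j n * inverse (\<rho> j (n - \<e> i)) + \<rho> i n * inverse (\<rho> i (n - \<e> j))
      = - (U \<rho> i j n + U \<rho> j i n)" for i j n
    by (simp add: U_def)
  have three: "\<rho> i n * inverse (\<rho> i (n - \<e> j)) + \<rho> j n * inverse (\<rho> j (n - \<e> k))
      + \<rho> k n * inverse (\<rho> k (n - \<e> i)) = - (U \<rho> i j n + U \<rho> j k n + U \<rho> k i n)" for i j k n
    by (simp add: U_def)
  have "hirota_miwa \<rho> \<longleftrightarrow> (\<forall>n i j. i \<noteq> j \<longrightarrow> U \<rho> i j n + U \<rho> j i n = 0) \<and>
      (\<forall>n i j k. i \<noteq> j \<and> j \<noteq> k \<and> i \<noteq> k \<longrightarrow> U \<rho> i j n + U \<rho> j k n + U \<rho> k i n = 0)"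
    unfolding hirota_miwa_def two three neg_equal_0_iff_equal ..
  also have "\<dots> \<longleftrightarrow> (\<forall>i j k n. W i j n + W j k n + W k i n = 0)" (is "?L \<longleftrightarrow> ?R")
  proof
    assume ?L
    then show ?R by (auto simp: W_def)
  next
    assume R: ?R
    have "U \<rho> i j n + U \<rho> j i n = 0" if "i \<noteq> j" for i j n
      using R[rule_format, of i j n i] that by (simp add: W_def)
    moreover have "U \<rho> i j n + U \<rho> j k n + U \<rho> k i n = 0" if "i \<noteq> j \<and> j \<noteq> k \<and> i \<noteq> k" for i j k n
      using R[rule_format, of i j n k] that by (simp add: W_def split: if_splits)
    ultimately show ?L by blast
  qed
  finally show ?thesis .
qed

lemma weight_constraint_iff_S:
  "(\<exists>F. weight_constraint \<rho> F) \<longleftrightarrow> (\<forall>n j k. S (n - \<e> j) = S (n - \<e> k))"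
  (is "?L \<longleftrightarrow> ?R")
proof
  assume ?L
  then show ?R
    by (auto simp: weight_constraint_def S_def A_def weight_minus_basis_vec)
next
  assume ?R
  then obtain g where "\<And>n. S n = g (weight n)"
    using function_of_weight[of S] by blast
  then have "weight_constraint \<rho> (\<lambda>w. 1 - g w)"
    by (simp add: weight_constraint_def S_def A_def)
  then show ?L by blast
qed

lemma linear_system_iff_W:
  "linear_system smul \<rho> \<psi> \<longleftrightarrow> (\<forall>n x i j. \<psi> (n - \<e> i) x - \<psi> (n - \<e> j) x = \<psi> n x \<bullet>\<^sub>R W i j n)"
  by (auto simp: linear_system_def W_def)

text \<open>With \<open>u\<close> as \<psi>(n) and \<open>a i\<close> as \<psi>(n + e_i), the linear
  system makes each bracket \<psi>(n - e_j + e_i), so the left side is x \<psi>(n - e_j) by the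
  additional equation.\<close>

lemma sum_step:
  "(\<Sum>i\<in>UNIV. (u - a i \<bullet>\<^sub>R W i j (n + \<e> i)) \<bullet>\<^sub>R A i (n - \<e> j)) =
    u \<bullet>\<^sub>R S (n - \<e> j) - (\<Sum>i\<in>UNIV. a i \<bullet>\<^sub>R (A i n * W i j n))"
  by (simp add: smul_diff_left sum_subtractf smul_smul W_mult_A S_def smul_sum_right)

text \<open>The cocycle relation makes \<open>W i k n - W i j n\<close> independent of
  \<open>i\<close>, so it factors out of the sum. The last term is then x \<psi>(n)
  \<open>W j k n\<close>, as the linear system predicts, and the \<open>S\<close> term is the
  obstruction.\<close>

lemma sum_step_diff:
  assumes W: "\<And>i j k n. W i j n + W j k n + W k i n = 0"
  shows "(\<Sum>i\<in>UNIV. (u - a i \<bullet>\<^sub>R W i j (n + \<e> i)) \<bullet>\<^sub>R A i (n - \<e> j))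
      - (\<Sum>i\<in>UNIV. (u - a i \<bullet>\<^sub>R W i k (n + \<e> i)) \<bullet>\<^sub>R A i (n - \<e> k))
    = u \<bullet>\<^sub>R (S (n - \<e> j) - S (n - \<e> k)) + (\<Sum>i\<in>UNIV. a i \<bullet>\<^sub>R A i n) \<bullet>\<^sub>R W j k n"
proof -
  have "W j k n = W i k n - W i j n" for i
  proof -
    have "W k i n = - W i k n"
      using W[of i k n i] by (simp add: W_def[of i i] eq_neg_iff_add_eq_0 add.commute)
    then show ?thesis using W[of i j n k] by (simp add: algebra_simps add_eq_0_iff2)
  qed
  then have "(\<Sum>i\<in>UNIV. a i \<bullet>\<^sub>R A i n) \<bullet>\<^sub>R W j k n
    = (\<Sum>i\<in>UNIV. a i \<bullet>\<^sub>R (A i n * (W i k n - W i j n)))"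
    unfolding smul_sum_left smul_smul by (intro sum.cong) simp_all
  then show ?thesis
    unfolding sum_step by (simp add: right_diff_distrib smul_diff_right sum_subtractf)
qed

section \<open>Necessity of the Hirota--Miwa system and the constraint\<close>

lemma compatible_imp:
  fixes v :: 'v
  assumes "compatible smul xmul \<rho>" and v: "v \<noteq> 0"
  shows "(\<forall>i j k n. W i j n + W j k n + W k i n = 0) \<and> (\<forall>n j k. S (n - \<e> j) = S (n - \<e> k))"
proof -
  have sol: "\<exists>\<psi>. linear_system smul \<rho> \<psi> \<and> additional_equation smul xmul \<rho> \<psi> \<and> (\<forall>x. \<psi> n x = v)"
    for n
  proof -
    fix i :: 'm
    \<comment> \<open>Data are prescribed at the neighbours of a base site; the base
      \<open>n - \<e> i\<close> has \<open>n\<close> among them.\<close>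
    obtain \<psi> where "linear_system smul \<rho> \<psi>" "additional_equation smul xmul \<rho> \<psi>"
        "\<forall>j x. \<psi> (n - \<e> i + \<e> j) x = v"
      using assms(1)[unfolded compatible_def, rule_format, of "n - \<e> i" "\<lambda>_ _. v"] by blast
    then show ?thesis by (metis diff_add_cancel)
  qed
  fix x :: 'x
  have W: "W i j n + W j k n + W k i n = 0" for i j k n
  proof -
    obtain \<psi> :: "int ^ 'm \<Rightarrow> 'x \<Rightarrow> 'v"
      where lin: "linear_system smul \<rho> \<psi>" and v_eq: "\<And>x. \<psi> n x = v"
      using sol by blast
    have L: "v \<bullet>\<^sub>R W p q n = \<psi> (n - \<e> p) x - \<psi> (n - \<e> q) x" for p q
      using lin[unfolded linear_system_iff_W] v_eq by metis
    have "v \<bullet>\<^sub>R (W i j n + W j k n + W k i n) = 0"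
      by (simp add: smul_add_right L)
    with v show ?thesis by (simp add: smul_eq_0_iff)
  qed
  moreover have "S (n - \<e> j) = S (n - \<e> k)" for n j k
  proof -
    obtain \<psi> where lin: "linear_system smul \<rho> \<psi>" and add: "additional_equation smul xmul \<rho> \<psi>"
      and v_eq: "\<And>x. \<psi> n x = v"
      using sol by blast
    let ?a = "\<lambda>i. \<psi> (n + \<e> i) x"
    have X: "xmul x (\<psi> p x) = (\<Sum>i\<in>UNIV. \<psi> (p + \<e> i) x \<bullet>\<^sub>R A i p)" for p
      using add by (simp add: additional_equation_def A_def)
    have "\<psi> (n - \<e> q + \<e> i) x = v - ?a i \<bullet>\<^sub>R W i q (n + \<e> i)" for i q
      using lin[unfolded linear_system_iff_W, rule_format, of "n + \<e> i" i x q] v_eq[of x]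
      by (simp add: algebra_simps)
    then have step: "xmul x (\<psi> (n - \<e> q) x) = (\<Sum>i\<in>UNIV. (v - ?a i \<bullet>\<^sub>R W i q (n + \<e> i)) \<bullet>\<^sub>R A i (n - \<e> q))"
      for q by (simp add: X)
    have "xmul x (\<psi> (n - \<e> j) x) - xmul x (\<psi> (n - \<e> k) x) = xmul x v \<bullet>\<^sub>R W j k n"
      using lin v_eq[of x] by (simp add: linear_system_iff_W xmul_smul flip: xmul_diff)
    also have "xmul x v = (\<Sum>i\<in>UNIV. ?a i \<bullet>\<^sub>R A i n)"
      using X[of n] v_eq[of x] by simp
    finally have "v \<bullet>\<^sub>R (S (n - \<e> j) - S (n - \<e> k)) = 0"
      unfolding step sum_step_diff[OF W] by simp
    with v show ?thesis by (simp add: smul_eq_0_iff)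
  qed
  ultimately show ?thesis by blast
qed

section \<open>Propagation of states\<close>

definition site_value :: "'x \<Rightarrow> int ^ 'm \<Rightarrow> ('m \<Rightarrow> 'v) \<Rightarrow> 'v"
  where "site_value x n a = inv (xmul x) (\<Sum>i\<in>UNIV. a i \<bullet>\<^sub>R A i n)"

text \<open>The component \<open>i\<close> is the value at n - e_j + e_i, read off from the linear
  equation at n + e_i. For \<open>i = j\<close> that site is \<open>n\<close> itself, in agreement
  with \<open>W j j = 0\<close>.\<close>

definition step :: "'x \<Rightarrow> 'm \<Rightarrow> int ^ 'm \<Rightarrow> ('m \<Rightarrow> 'v) \<Rightarrow> ('m \<Rightarrow> 'v)"
  where "step x j n a = (\<lambda>i. site_value x n a - a i \<bullet>\<^sub>R W i j (n + \<e> i))"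

lemma xmul_site_value: "xmul x (site_value x n a) = (\<Sum>i\<in>UNIV. a i \<bullet>\<^sub>R A i n)"
  using bij_xmul[of x] by (simp add: site_value_def bij_is_surj surj_f_inv_f)

lemma step_diag: "step x j n a j = site_value x n a"
  by (simp add: step_def W_def)

text \<open>The image reveals the site value in component \<open>j\<close>. The other components
  then determine \<open>a i\<close> because \<open>W i j\<close> is nonzero, and the additional
  equation determines \<open>a j\<close> because \<open>A j n\<close> is nonzero.\<close>

lemma bij_step: "bij (step x j n)"
proof (rule bijI)
  have sum_split: "(\<Sum>i\<in>UNIV. a i \<bullet>\<^sub>R A i n) = a j \<bullet>\<^sub>R A j n + (\<Sum>i\<in>UNIV - {j}. a i \<bullet>\<^sub>R A i n)"
    for a :: "'m \<Rightarrow> 'v"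
    by (simp add: sum.remove)
  show "inj (step x j n)"
  proof (rule injI)
    fix a b assume eq: "step x j n a = step x j n b"
    then have val: "site_value x n a = site_value x n b"
      by (metis step_diag)
    have off: "a i = b i" if "i \<noteq> j" for i
    proof -
      have "(a i - b i) \<bullet>\<^sub>R W i j (n + \<e> i) = 0"
        using fun_cong[OF eq, of i] val by (simp add: step_def smul_diff_left)
      then show ?thesis using W_nonzero[OF that] by (simp add: smul_eq_0_iff)
    qed
    have "(\<Sum>i\<in>UNIV. a i \<bullet>\<^sub>R A i n) = (\<Sum>i\<in>UNIV. b i \<bullet>\<^sub>R A i n)"
      using val xmul_site_value by metis
    then have "(a j - b j) \<bullet>\<^sub>R A j n = 0"
      using off by (simp add: sum_split smul_diff_left)
    then have "a j = b j" using A_nonzero by (simp add: smul_eq_0_iff)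
    with off show "a = b" by (intro ext) metis
  qed
  show "surj (step x j n)"
    unfolding surj_def
  proof
    fix b :: "'m \<Rightarrow> 'v"
    \<comment> \<open>Off \<open>j\<close> the linear equations are solved for the state; component
      \<open>j\<close> is then chosen so that the site value becomes \<open>b j\<close>.\<close>
    define a' where "a' i = (b j - b i) \<bullet>\<^sub>R inverse (W i j (n + \<e> i))" for i
    define a where "a = a'(j := (xmul x (b j) - (\<Sum>i\<in>UNIV - {j}. a' i \<bullet>\<^sub>R A i n)) \<bullet>\<^sub>R inverse (A j n))"
    have "xmul x (site_value x n a) = xmul x (b j)"
      unfolding xmul_site_value sum_split by (simp add: a_def smul_smul smul_one A_nonzero)
    then have val: "site_value x n a = b j" by (simp add: xmul_eq_iff)
    have off: "a i = (b j - b i) \<bullet>\<^sub>R inverse (W i j (n + \<e> i))" if "i \<noteq> j" for i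
      using that by (simp add: a_def a'_def)
    have "step x j n a i = b i" for i
    proof (cases "i = j")
      case True
      then show ?thesis by (simp add: step_diag val)
    next
      case False
      then show ?thesis
        by (simp add: step_def val off smul_smul smul_one W_nonzero)
    qed
    then show "\<exists>a. b = step x j n a" by (intro exI[of _ a]) (rule ext, rule sym)
  qed
qed

text \<open>The Hirota--Miwa system contains only the cocycle relation at \<open>n\<close>; the one at shifted sites
  follows by conjugation with \<open>W_mult_W\<close>.\<close>

lemma W_shifted:
  assumes W: "\<And>i j k n. W i j n + W j k n + W k i n = 0"
    and "i \<noteq> j" "j \<noteq> k" "i \<noteq> k"
  shows "W i j (p - \<e> k) + W j k (p - \<e> i) + W k i (p - \<e> j) = 0"
proof -
  have anti: "W i j n = - W j i n" for i j n
    using W[of i j n i] by (simp add: W_def[of i i] eq_neg_iff_add_eq_0)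
  let ?z = "W i k (p - \<e> j)"
  have 1: "W i k p * W i j (p - \<e> k) = W i j p * ?z"
    by (simp add: W_mult_W)
  have "W k i p * W k j (p - \<e> i) = W k j p * W k i (p - \<e> j)"
    by (simp add: W_mult_W)
  then have 2: "W i k p * W j k (p - \<e> i) = W j k p * ?z"
    by (simp add: anti[of k])
  have 3: "W i k p * W k i (p - \<e> j) = W k i p * ?z"
    by (simp add: anti[of k i])
  have "W i k p * (W i j (p - \<e> k) + W j k (p - \<e> i) + W k i (p - \<e> j))
    = (W i j p + W j k p + W k i p) * ?z"
    by (simp only: distrib_left distrib_right 1 2 3)
  then show ?thesis using W[of i j p k] W_nonzero[of i k p] assms(4) by simp
qed

text \<open>Component \<open>i\<close> of either side represents \<psi>(n + e_i - e_j - e_k). The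
  two site values differ by \<psi>(n) \<open>W j k n\<close>, and the remaining corrections
  compensate exactly this difference.\<close>

lemma step_commute:
  assumes W: "\<And>i j k n. W i j n + W j k n + W k i n = 0"
    and S: "\<And>n j k. S (n - \<e> j) = S (n - \<e> k)"
  shows "step x k (n - \<e> j) (step x j n a) = step x j (n - \<e> k) (step x k n a)"
proof (cases "j = k")
  case False
  have anti: "W i j n = - W j i n" for i j n
    using W[of i j n i] by (simp add: W_def[of i i] eq_neg_iff_add_eq_0)
  let ?u = "site_value x n a"
  have "xmul x (site_value x (n - \<e> j) (step x j n a) - site_value x (n - \<e> k) (step x k n a))
    = xmul x (?u \<bullet>\<^sub>R W j k n)"
    unfolding xmul_diff xmul_site_value step_def sum_step_diff[OF W] xmul_smul
    using S[of n j k] by simp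
  then have val: "site_value x (n - \<e> j) (step x j n a)
      = site_value x (n - \<e> k) (step x k n a) + ?u \<bullet>\<^sub>R W j k n"
    by (simp add: xmul_eq_iff algebra_simps)
  have "?u \<bullet>\<^sub>R W j k n = step x j n a i \<bullet>\<^sub>R W i k (n - \<e> j + \<e> i) - step x k n a i \<bullet>\<^sub>R W i j (n - \<e> k + \<e> i)"
    for i
  proof -
    consider "i = j" | "i = k" | "i \<noteq> j" "i \<noteq> k" by blast
    then show ?thesis
    proof cases
      case 1
      then show ?thesis by (simp add: step_diag W_def[of i i] W_def[of j j])
    next
      case 2
      then show ?thesis
        using anti[of j k n] by (simp add: step_diag W_def[of k k] smul_minus_right)
    next
      case 3
      let ?p = "n + \<e> i"
      have p: "n - \<e> j + \<e> i = ?p - \<e> j" "n - \<e> k + \<e> i = ?p - \<e> k" by simp_all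
      \<comment> \<open>The shifted cocycle relation balances the terms in \<open>?u\<close>; the
        terms in \<open>a i\<close> cancel by \<open>W_mult_W\<close>.\<close>
      have "W j k n = W i k (?p - \<e> j) - W i j (?p - \<e> k)"
        using W_shifted[OF W, of i j k ?p] 3 False anti[of k i "?p - \<e> j"]
        by (simp add: algebra_simps add_eq_0_iff2)
      then show ?thesis
        unfolding p step_def
        by (simp add: smul_diff_left smul_diff_right smul_smul W_mult_W[of i j ?p k])
    qed
  qed
  moreover have "w + c - p = w - q" if "c = p - q" for c p q w :: 'v
    using that by simp
  ultimately show ?thesis
    unfolding step_def[of x k "n - \<e> j"] step_def[of x j "n - \<e> k"] val
    by (intro ext) blast
qed simp

section \<open>Construction of the global solution\<close>

lemma compatibleI:
  assumes W: "\<And>i j k n. W i j n + W j k n + W k i n = 0"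
    and S: "\<And>n j k. S (n - \<e> j) = S (n - \<e> k)"
  shows "compatible smul xmul \<rho>"
  unfolding compatible_def
proof (intro allI)
  fix n\<^sub>0 :: "int ^ 'm" and v :: "'m \<Rightarrow> 'x \<Rightarrow> 'v"
  have "\<forall>x. \<exists>a. a n\<^sub>0 = (\<lambda>i. v i x) \<and> (\<forall>j n. a (n - \<e> j) = step x j n (a n))"
    by (intro allI flat_transport bij_step step_commute W S)
  then obtain a where init: "\<And>x. a x n\<^sub>0 = (\<lambda>i. v i x)"
    and a: "\<And>x j n. a x (n - \<e> j) = step x j n (a x n)"
    by metis
  define \<psi> where "\<psi> n x = site_value x n (a x n)" for n x
  \<comment> \<open>Propagating from \<open>n + \<e> i\<close> in direction \<open>i\<close> returns
    the site value in component \<open>i\<close>, so the transported states consist of neighbouring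
    values of \<psi>.\<close>
  have \<psi>_shift: "\<psi> (n + \<e> i) x = a x n i" for n i x
    using a[of x "n + \<e> i" i] by (simp add: \<psi>_def step_diag)
  have "linear_system smul \<rho> \<psi>"
    unfolding linear_system_iff_W
  proof (intro allI)
    fix n x i j
    \<comment> \<open>The linear equation at \<open>n\<close> is component \<open>i\<close> of the
      step in direction \<open>j\<close> from the site \<open>n - \<e> i\<close>.\<close>
    have "\<psi> (n - \<e> j) x = a x (n - \<e> i - \<e> j) i"
      using \<psi>_shift[of "n - \<e> i - \<e> j" i x] by (simp add: algebra_simps)
    also have "\<dots> = \<psi> (n - \<e> i) x - \<psi> n x \<bullet>\<^sub>R W i j n"
      unfolding a[of x "n - \<e> i" j] step_def
      using \<psi>_shift[of "n - \<e> i" i x] by (simp add: \<psi>_def)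
    finally show "\<psi> (n - \<e> i) x - \<psi> (n - \<e> j) x = \<psi> n x \<bullet>\<^sub>R W i j n" by simp
  qed
  moreover have "additional_equation smul xmul \<rho> \<psi>"
    unfolding additional_equation_def \<psi>_shift
    by (simp add: \<psi>_def xmul_site_value flip: A_def)
  moreover have "\<forall>i x. \<psi> (n\<^sub>0 + \<e> i) x = v i x"
    by (simp add: \<psi>_shift init)
  ultimately show "\<exists>\<psi>. linear_system smul \<rho> \<psi> \<and> additional_equation smul xmul \<rho> \<psi> \<and>
      (\<forall>i x. \<psi> (n\<^sub>0 + \<e> i) x = v i x)"
    by blast
qed

end

theorem theorem4p2:
  fixes smul :: "'v::ab_group_add \<Rightarrow> 'd::division_ring \<Rightarrow> 'v"
    and xmul :: "'x \<Rightarrow> 'v \<Rightarrow> 'v"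
    and \<rho> :: "'m::finite \<Rightarrow> int ^ 'm \<Rightarrow> 'd"
  assumes "CARD('m) \<ge> 2"
    and "right_vector_space_with_parameter smul xmul"
    and "\<exists>v::'v. v \<noteq> 0"
    and "\<And>i n. \<rho> i n \<noteq> 0"
  shows "compatible smul xmul \<rho> \<longleftrightarrow>
    hirota_miwa \<rho> \<and> (\<exists>F :: int \<Rightarrow> 'd. weight_constraint \<rho> F)"
proof -
  interpret right_vector_space_with_parameter smul xmul by fact
  interpret wave_potentials smul xmul \<rho> by unfold_locales fact
  show ?thesis
    unfolding hirota_miwa_iff_W weight_constraint_iff_S
    using assms(3) compatible_imp compatibleI by blast
qed

end
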